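(* Let $r\ge0$ be an integer, let $\alpha\in\mathbb C$, let $F\in\mathbb C[[z]]$ be Möbius-covariant of weight $\alpha$, put $p:=\frac{r-1-\alpha}{2}$, and let $c\in\mathbb C^\times$. Then $$[z^r]\,(1+z)^pF(-z/c)=c^{-r}\,[z^r]\,\bigl(1+(c-2)z-(c-1)z^2\bigr)^pF(z),$$ where the quadratic factors as $$1+(c-2)z-(c-1)z^2=(1-z)(1+(c-1)z).$$
   Context: $[z^r]H(z)$ denotes the coefficient of $z^r$ in the formal power series $H(z)$. For $\beta\in\mathbb C$ and $w\in z\mathbb C[[z]]$, $(1+w)^\beta:=\sum_{k\ge0}\binom{\beta}{k}w^k$. A series $F\in\mathbb C[[z]]$ is Möbius-covariant of weight $\alpha$ if $F\!\left(-\frac{z}{1-z}\right)=(1-z)^{-\alpha}F(z)$ in $\mathbb C[[z]]$. *)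

theory Defs
  imports "HOL-Computational_Algebra.Formal_Power_Series"
begin

unbundle fps_syntax

text \<open>
  Binomial power written as a function of its base \<open>G = 1 + w\<close>: by the definition of
  \<open>fps_binomial\<close>, this is the sum over \<open>k\<close> of \<open>(\<beta> gchoose k) * w ^ k\<close> with \<open>w = G - 1\<close>.
  It is meaningful only when \<open>G $ 0 = 1\<close>, i.e. when \<open>w\<close> has no constant term.
\<close>

definition fps_cpow :: "complex fps \<Rightarrow> complex \<Rightarrow> complex fps" where
  "fps_cpow G \<beta> = fps_binomial \<beta> oo (G - 1)"

definition moebius_covariant :: "complex \<Rightarrow> complex fps \<Rightarrow> bool" where
  "moebius_covariant \<alpha> F \<longleftrightarrow>
     F oo (- (fps_X / (1 - fps_X))) = fps_cpow (1 - fps_X) (- \<alpha>) * F"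

end

theory Submission
  imports Defs
begin

text \<open>
  With \<open>z = -c u\<close> the left-hand side is \<open>(-c)\<^sup>-\<^sup>r [u\<^sup>r] (1 - c u)\<^sup>p F u\<close>. Put
  \<open>u = -t / (1 - t)\<close>, so that \<open>F u = (1 - t)\<^sup>-\<^sup>\<alpha> F t\<close> and
  \<open>1 - c u = (1 + (c - 1) t) / (1 - t)\<close>. The residue change of variables contributes the factor
  \<open>(-1)\<^sup>r (1 - t)\<^sup>r\<^sup>-\<^sup>1\<close>, and the total exponent of \<open>1 - t\<close> is \<open>r - 1 - \<alpha> - p = p\<close>.
\<close>

lemma fps_cpow_nth_0 [simp]: "fps_cpow G b $ 0 = 1"
  by (simp add: fps_cpow_def)

lemma fps_cpow_add:
  assumes "G $ 0 = 1"
  shows "fps_cpow G (a + b) = fps_cpow G a * fps_cpow G b"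
  using assms by (simp add: fps_cpow_def fps_binomial_add_mult fps_compose_mult_distrib)

lemma fps_cpow_0 [simp]: "fps_cpow G 0 = 1"
  by (simp add: fps_cpow_def)

lemma fps_cpow_1:
  assumes "G $ 0 = 1"
  shows "fps_cpow G 1 = G"
  using assms by (simp add: fps_cpow_def fps_binomial_1 fps_compose_add_distrib)

lemma fps_cpow_compose:
  assumes "G $ 0 = 1" "u $ 0 = 0"
  shows "fps_cpow G b oo u = fps_cpow (G oo u) b"
  using assms by (simp add: fps_cpow_def fps_compose_sub_distrib flip: fps_compose_assoc)

text \<open>The differential equation \<open>(1 + X) B' = b B\<close> of the binomial series,
  composed with \<open>G - 1\<close>; the chain rule supplies the factor \<open>fps_deriv G\<close>.
  Multiplying by \<open>G\<close> avoids a division.\<close>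

lemma fps_cpow_deriv:
  assumes "G $ 0 = 1"
  shows "fps_deriv (fps_cpow G b) * G = fps_const b * fps_deriv G * fps_cpow G b"
proof -
  have G: "(1 + fps_X) oo (G - 1) = G"
    using assms by (simp add: fps_compose_add_distrib)
  have "fps_deriv (fps_binomial b) * (1 + fps_X) = fps_const b * fps_binomial b"
    by (simp add: fps_binomial_deriv fps_divide_unit mult.assoc inverse_mult_eq_1)
  then have "(fps_deriv (fps_binomial b) oo (G - 1)) * ((1 + fps_X) oo (G - 1))
      = fps_const b * (fps_binomial b oo (G - 1))"
    using assms by (metis fps_compose_mult_distrib fps_const_compose fps_sub_nth fps_one_nth diff_self)
  then show ?thesis
    using assms unfolding G
    by (simp add: fps_cpow_def fps_compose_deriv algebra_simps)
qed

text \<open>Multiplying the left side by the powers with exponent \<open>- b\<close> of both bases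
  gives a series whose logarithmic derivative cancels, so it is constant, equal to 1.\<close>

lemma fps_cpow_mult_base:
  assumes G: "G $ 0 = 1" and H: "H $ 0 = 1"
  shows "fps_cpow (G * H) b = fps_cpow G b * fps_cpow H b"
proof -
  have GH: "(G * H) $ 0 = 1" using assms by simp
  define P where "P = fps_cpow (G * H) b"
  define A where "A = fps_cpow G (- b)"
  define B where "B = fps_cpow H (- b)"
  have P: "fps_deriv P * (G * H) = fps_const b * (fps_deriv G * H + G * fps_deriv H) * P"
    using fps_cpow_deriv[OF GH, of b] by (simp add: P_def algebra_simps)
  have A: "fps_deriv A * G = - (fps_const b * fps_deriv G * A)"
    using fps_cpow_deriv[OF G, of "- b"] by (simp add: A_def flip: fps_const_neg)
  have B: "fps_deriv B * H = - (fps_const b * fps_deriv H * B)"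
    using fps_cpow_deriv[OF H, of "- b"] by (simp add: B_def flip: fps_const_neg)
  have "fps_deriv (P * A * B) * (G * H)
      = (fps_deriv P * (G * H)) * A * B + P * (fps_deriv A * G) * H * B
        + P * A * G * (fps_deriv B * H)"
    by (simp add: algebra_simps)
  also have "\<dots> = 0"
    unfolding P A B by (simp add: algebra_simps)
  \<comment> \<open>\<open>G * H\<close> has constant term 1, hence is nonzero and cancels in the
    integral domain of power series.\<close>
  finally have "fps_deriv (P * A * B) = 0"
    using GH by (metis mult_eq_0_iff fps_zero_nth zero_neq_one)
  then have "P * A * B = fps_const ((P * A * B) $ 0)"
    by (simp only: fps_deriv_eq_0_iff)
  then have 1: "P * A * B = 1"
    by (simp add: P_def A_def B_def)
  have "fps_cpow G b * A = 1" "fps_cpow H b * B = 1"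
    using fps_cpow_add[OF G, of b "- b"] fps_cpow_add[OF H, of b "- b"] by (simp_all add: A_def B_def)
  then have "P = P * (fps_cpow G b * A) * (fps_cpow H b * B)" by simp
  also have "\<dots> = fps_cpow G b * fps_cpow H b * (P * A * B)"
    by (simp only: ac_simps)
  finally show ?thesis by (simp only: 1 mult_1_right flip: P_def)
qed

lemma fps_cpow_one_minus_X_nth:
  "fps_cpow (1 - fps_X) b $ n = (- 1) ^ n * (b gchoose n)"
proof -
  have "fps_cpow (1 - fps_X) b = fps_binomial b oo (fps_const (- 1) * fps_X)"
    by (simp add: fps_cpow_def flip: fps_const_neg)
  then show ?thesis
    by (simp only: fps_nth_compose_linear fps_binomial_nth)
qed

text \<open>Each factor \<open>- (X / (1 - X))\<close> contributes a sign and an \<open>X\<close>,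
  and its denominator lowers the exponent of \<open>1 - X\<close> by one.\<close>

lemma fps_cpow_moebius_power:
  "fps_cpow (1 - fps_X) b * (- (fps_X / (1 - fps_X))) ^ k
     = fps_const ((- 1) ^ k) * (fps_X ^ k * fps_cpow (1 - fps_X) (b - of_nat k))"
proof (induction k)
  case (Suc k)
  have *: "fps_cpow (1 - fps_X) (b - of_nat k)
      = fps_cpow (1 - fps_X) (b - of_nat (Suc k)) * (1 - fps_X)"
    using fps_cpow_add[of "1 - fps_X" "b - of_nat (Suc k)" 1] fps_cpow_1[of "1 - fps_X"] by simp
  have inv: "(1 - fps_X) * (fps_X / (1 - fps_X)) = (fps_X :: complex fps)"
    by (simp add: fps_divide_unit ac_simps inverse_mult_eq_1')
  have "fps_cpow (1 - fps_X) b * (- (fps_X / (1 - fps_X))) ^ Suc k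
      = fps_const ((- 1) ^ k) * (fps_X ^ k * fps_cpow (1 - fps_X) (b - of_nat k))
        * (- (fps_X / (1 - fps_X)))"
    unfolding Suc[symmetric] by (simp only: power_Suc2 mult.assoc)
  also have "\<dots> = - (fps_const ((- 1) ^ k) * (fps_X ^ k * fps_cpow (1 - fps_X) (b - of_nat (Suc k)))
        * ((1 - fps_X) * (fps_X / (1 - fps_X))))"
    unfolding * by (simp only: mult_minus_left mult_minus_right ac_simps)
  also have "\<dots> = fps_const ((- 1) ^ Suc k)
      * (fps_X ^ Suc k * fps_cpow (1 - fps_X) (b - of_nat (Suc k)))"
    unfolding inv by (simp add: ac_simps flip: fps_const_neg)
  finally show ?case .
qed simp

text \<open>The residue change of variables \<open>u = -t / (1 - t)\<close>, checked on the monomials \<open>u\<^sup>k\<close>.\<close>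

lemma fps_nth_moebius_compose:
  "(fps_cpow (1 - fps_X) (of_nat r - 1) * (G oo (- (fps_X / (1 - fps_X))))) $ r = (- 1) ^ r * G $ r"
proof -
  let ?u = "- (fps_X / (1 - fps_X)) :: complex fps"
  let ?W = "fps_cpow (1 - fps_X) (of_nat r - 1)"
  have u0: "?u $ 0 = 0" by (simp add: fps_divide_unit)
  \<comment> \<open>This is why the weight has exponent \<open>r - 1\<close>: for
    \<open>k = r - n\<close> the coefficient at \<open>r\<close> is, up to sign, this binomial, so
    only the monomial \<open>k = r\<close> survives.\<close>
  have vanish: "(of_nat n - 1 :: complex) gchoose n = (if n = 0 then 1 else 0)" for n
  proof (cases n)
    case (Suc m)
    then show ?thesis by (simp flip: binomial_gbinomial)
  qed simp
  have mono: "(?W * ?u ^ k) $ r = (if k = r then (- 1) ^ r else 0)" for k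
  proof (cases "k \<le> r")
    case True
    then obtain n where n: "r = k + n" using le_Suc_ex by blast
    have e: "of_nat r - 1 - of_nat k = (of_nat n - 1 :: complex)" by (simp add: n)
    show ?thesis
      unfolding fps_cpow_moebius_power e
      by (simp add: fps_X_power_mult_nth fps_cpow_one_minus_X_nth vanish n)
  next
    case False
    then show ?thesis
      unfolding fps_cpow_moebius_power by (simp add: fps_X_power_mult_nth)
  qed
  \<comment> \<open>Since \<open>?u ^ k\<close> has no terms below degree \<open>k\<close>, this
    finite sum agrees with the composition up to degree \<open>r\<close>, and linearity reduces the
    claim to monomials.\<close>
  define T where "T = (\<Sum>k\<le>r. fps_const (G $ k) * ?u ^ k)"
  have "(G oo ?u) $ i = T $ i" if "i \<le> r" for i
  proof -
    have "(G oo ?u) $ i = (\<Sum>k=0..i. G $ k * (?u ^ k) $ i)" by (rule fps_compose_nth)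
    also have "\<dots> = (\<Sum>k\<le>r. G $ k * (?u ^ k) $ i)"
      using that by (intro sum.mono_neutral_left) (auto intro: startsby_zero_power_prefix[OF u0, rule_format])
    finally show ?thesis by (simp add: T_def fps_sum_nth)
  qed
  then have "(?W * (G oo ?u)) $ r = (?W * T) $ r"
    by (simp add: fps_mult_nth)
  also have "?W * T = (\<Sum>k\<le>r. fps_const (G $ k) * (?W * ?u ^ k))"
    unfolding T_def sum_distrib_left by (simp only: ac_simps)
  also have "\<dots> $ r = (\<Sum>k\<le>r. G $ k * (?W * ?u ^ k) $ r)"
    by (simp only: fps_sum_nth fps_mult_left_const_nth)
  also have "\<dots> = (- 1) ^ r * G $ r"
    unfolding mono by (simp add: if_distrib cong: if_cong)
  finally show ?thesis .
qed

theorem proposition2p10: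
  fixes r :: nat and \<alpha> p c :: complex and F :: "complex fps"
  assumes "moebius_covariant \<alpha> F"
    and "p = (of_nat r - 1 - \<alpha>) / 2"
    and "c \<noteq> 0"
  shows "(fps_cpow (1 + fps_X) p * (F oo (fps_const (- 1 / c) * fps_X))) $ r
       = c powi (- int r) *
         (fps_cpow (1 + fps_const (c - 2) * fps_X - fps_const (c - 1) * fps_X ^ 2) p * F) $ r
       \<and> 1 + fps_const (c - 2) * fps_X - fps_const (c - 1) * fps_X ^ 2
         = (1 - fps_X) * (1 + fps_const (c - 1) * fps_X)"
proof -
  let ?u = "- (fps_X / (1 - fps_X)) :: complex fps"
  let ?s = "fps_const (- 1 / c) * fps_X :: complex fps"
  let ?L = "1 - fps_const c * fps_X :: complex fps"
  let ?M = "1 + fps_const (c - 1) * fps_X :: complex fps"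
  let ?E = "fps_cpow (1 - fps_X)"
  have u0: "?u $ 0 = 0" by (simp add: fps_divide_unit)
  have X0: "(1 - fps_X :: complex fps) $ 0 = 1" by simp
  have factor: "1 + fps_const (c - 2) * fps_X - fps_const (c - 1) * fps_X ^ 2 = (1 - fps_X) * ?M"
  proof -
    have e: "fps_const (c - 1) = fps_const (c - 2) + 1"
      by (simp flip: fps_const_1_eq_1)
    show ?thesis unfolding e by (simp add: algebra_simps power2_eq_square)
  qed
  \<comment> \<open>Chosen so that the rescaling \<open>?s\<close> turns it into the series on the
    left, while the substitution \<open>?u\<close> leads to the one on the right.\<close>
  define G where "G = fps_cpow ?L p * F"
  have "fps_const c * fps_X oo ?s = fps_const (c * (- 1 / c)) * fps_X"
    by (simp add: fps_compose_mult_distrib flip: mult.assoc)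
  then have "?L oo ?s = 1 + fps_X"
    using \<open>c \<noteq> 0\<close> by (simp add: fps_compose_sub_distrib flip: fps_const_neg)
  then have "fps_cpow (1 + fps_X) p * (F oo ?s) = G oo ?s"
    by (simp add: G_def fps_compose_mult_distrib fps_cpow_compose)
  then have lhs: "(fps_cpow (1 + fps_X) p * (F oo ?s)) $ r = (- 1 / c) ^ r * G $ r"
    by (simp only: fps_nth_compose_linear)
  have inv: "(fps_X / (1 - fps_X)) * (1 - fps_X) = (fps_X :: complex fps)"
    by (simp add: fps_divide_unit mult.assoc inverse_mult_eq_1)
  \<comment> \<open>The identity \<open>1 - c u = (1 + (c - 1) t) / (1 - t)\<close> with its
    denominator cleared.\<close>
  have "(?L oo ?u) * (1 - fps_X) = (1 - fps_X) + fps_const c * ((fps_X / (1 - fps_X)) * (1 - fps_X))"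
    using u0 by (simp add: fps_compose_sub_distrib fps_compose_mult_distrib algebra_simps)
  also have "\<dots> = ?M"
    unfolding inv by (simp add: algebra_simps flip: fps_const_sub)
  finally have M: "fps_cpow (?L oo ?u) p * ?E p = fps_cpow ?M p"
    by (subst fps_cpow_mult_base[symmetric]) (simp_all del: fps_const_sub)
  have exponent: "of_nat r - 1 = p + (p + \<alpha>)"
    unfolding assms(2) by (simp add: field_simps)
  have "?E (of_nat r - 1) * (G oo ?u)
      = ?E (p + (p + \<alpha>)) * (fps_cpow (?L oo ?u) p * (?E (- \<alpha>) * F))"
    using assms(1) u0
    by (simp add: G_def exponent moebius_covariant_def fps_compose_mult_distrib fps_cpow_compose)
  \<comment> \<open>The weight of \<open>F\<close> cancels; one \<open>?E p\<close> clears the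
    denominator of \<open>?L oo ?u\<close>, the other becomes the linear factor \<open>1 - X\<close>
    of the quadratic.\<close>
  also have "\<dots> = (?E \<alpha> * ?E (- \<alpha>)) * (fps_cpow (?L oo ?u) p * ?E p) * ?E p * F"
    by (simp only: fps_cpow_add[OF X0] ac_simps)
  also have "?E \<alpha> * ?E (- \<alpha>) = 1"
    using fps_cpow_add[OF X0, of \<alpha> "- \<alpha>"] by simp
  also have "1 * (fps_cpow (?L oo ?u) p * ?E p) * ?E p * F = fps_cpow ((1 - fps_X) * ?M) p * F"
    unfolding M by (subst fps_cpow_mult_base) (simp_all add: ac_simps del: fps_const_sub)
  finally have "(- 1) ^ r * G $ r = (fps_cpow ((1 - fps_X) * ?M) p * F) $ r"
    by (simp flip: fps_nth_moebius_compose)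
  moreover have "(- 1 / c) ^ r = c powi (- int r) * (- 1) ^ r"
    by (simp only: power_int_minus power_int_of_nat divide_inverse power_mult_distrib power_inverse
        mult.commute)
  ultimately show ?thesis
    unfolding factor lhs by (simp add: mult.assoc)
qed

end
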